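(* Let $S$ be an intra-regular $\Gamma$-AG$^{\ast\ast}$-groupoid and let $A=(\mu_A,\gamma_A)$ be an intuitionistic fuzzy set of $S$. Then the following conditions are equivalent. (i) $A$ is an intuitionistic fuzzy $\Gamma$-bi-ideal of $S$. (ii) $(A\circ_\Gamma\delta)\circ_\Gamma A=A$ and $A\circ_\Gamma A=A$, where $\delta=(S_\delta,\Theta_\delta)$.
   Context: Let $S,\Gamma$ be nonempty sets with a map $S\times\Gamma\times S\to S$, $(x,\alpha,y)\mapsto x\alpha y$. $S$ is a $\Gamma$-AG-groupoid if $(x\alpha y)\beta z=(z\alpha y)\beta x$ for all $x,y,z\in S$, $\alpha,\beta\in\Gamma$. It is a $\Gamma$-AG$^{\ast\ast}$-groupoid if moreover $x\alpha(y\beta z)=y\alpha(x\beta z)$ for all $x,y,z\in S$, $\alpha,\beta\in\Gamma$. $S$ is intra-regular if for every $a\in S$ there exist $x,y\in S$ and $\alpha,\beta,\gamma\in\Gamma$ with $a=(x\alpha(a\beta a))\gamma y$. An intuitionistic fuzzy set (IFS) of $S$ is a pair $A=(\mu_A,\gamma_A)$ of functions $\mu_A,\gamma_A:S\to[0,1]$ with $0\le\mu_A(x)+\gamma_A(x)\le1$ for all $x\in S$. Let $\delta=(S_\delta,\Theta_\delta)$ be the IFS with $S_\delta(x)=1$, $\Theta_\delta(x)=0$ for all $x$. The product $A\circ_\Gamma B=(\mu_A\circ_\Gamma\mu_B,\gamma_A\circ_\Gamma\gamma_B)$ is given by $(\mu_A\circ_\Gamma\mu_B)(a)=\sup\{\mu_A(b)\wedge\mu_B(c)\}$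 and $(\gamma_A\circ_\Gamma\gamma_B)(a)=\inf\{\gamma_A(b)\vee\gamma_B(c)\}$, over all $b,c\in S$, $\beta\in\Gamma$ with $a=b\beta c$, if such a factorization exists, and by $0$ and $1$ respectively otherwise. Here $\wedge=\min$, $\vee=\max$. An IFS $A$ of $S$ is an intuitionistic fuzzy $\Gamma$-bi-ideal if for all $x,a,y\in S$ and $\alpha,\beta\in\Gamma$: $\mu_A(x\alpha y)\ge\mu_A(x)\wedge\mu_A(y)$, $\gamma_A(x\alpha y)\le\gamma_A(x)\vee\gamma_A(y)$, $\mu_A((x\alpha a)\beta y)\ge\mu_A(x)\wedge\mu_A(y)$ and $\gamma_A((x\alpha a)\beta y)\le\gamma_A(x)\vee\gamma_A(y)$. *)

theory Defs
  imports Complex_Main "HOL-Library.FuncSet"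
begin

locale gamma_AG_groupoid =
  fixes S :: "'a set" and G :: "'g set" and m :: "'a \<Rightarrow> 'g \<Rightarrow> 'a \<Rightarrow> 'a"
  assumes S_nonempty: "S \<noteq> {}"
    and G_nonempty: "G \<noteq> {}"
    and closed: "\<lbrakk>x \<in> S; \<alpha> \<in> G; y \<in> S\<rbrakk> \<Longrightarrow> m x \<alpha> y \<in> S"
    and left_invertive:
      "\<lbrakk>x \<in> S; y \<in> S; z \<in> S; \<alpha> \<in> G; \<beta> \<in> G\<rbrakk> \<Longrightarrow> m (m x \<alpha> y) \<beta> z = m (m z \<alpha> y) \<beta> x"

locale gamma_AG_star_star_groupoid = gamma_AG_groupoid +
  assumes star_star:
    "\<lbrakk>x \<in> S; y \<in> S; z \<in> S; \<alpha> \<in> G; \<beta> \<in> G\<rbrakk> \<Longrightarrow> m x \<alpha> (m y \<beta> z) = m y \<alpha> (m x \<beta> z)"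

definition intra_regular :: "'a set \<Rightarrow> 'g set \<Rightarrow> ('a \<Rightarrow> 'g \<Rightarrow> 'a \<Rightarrow> 'a) \<Rightarrow> bool" where
  "intra_regular S G m \<longleftrightarrow>
    (\<forall>a\<in>S. \<exists>x\<in>S. \<exists>y\<in>S. \<exists>\<alpha>\<in>G. \<exists>\<beta>\<in>G. \<exists>\<gamma>\<in>G. a = m (m x \<alpha> (m a \<beta> a)) \<gamma> y)"

text \<open>
  Functions from \<open>S\<close> to the unit interval are represented extensionally (they are
  \<^const>\<open>undefined\<close> outside \<open>S\<close>), so that equality of pairs of HOL functions is exactly
  equality of intuitionistic fuzzy sets of \<open>S\<close>. The operations below are restricted
  to \<open>S\<close> accordingly.
\<close>

type_synonym 'a fuzzy_pair = "('a \<Rightarrow> real) \<times> ('a \<Rightarrow> real)"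

definition IFS :: "'a set \<Rightarrow> 'a fuzzy_pair set" where
  "IFS S = {(\<mu>, \<nu>). \<mu> \<in> S \<rightarrow>\<^sub>E {0..1} \<and> \<nu> \<in> S \<rightarrow>\<^sub>E {0..1} \<and>
    (\<forall>x\<in>S. 0 \<le> \<mu> x + \<nu> x \<and> \<mu> x + \<nu> x \<le> 1)}"

definition ifs_delta :: "'a set \<Rightarrow> 'a fuzzy_pair" where
  "ifs_delta S = (\<lambda>x\<in>S. 1, \<lambda>x\<in>S. 0)"

definition factorizations ::
    "'a set \<Rightarrow> 'g set \<Rightarrow> ('a \<Rightarrow> 'g \<Rightarrow> 'a \<Rightarrow> 'a) \<Rightarrow> 'a \<Rightarrow> ('a \<times> 'a) set" where
  "factorizations S G m a = {(b, c). b \<in> S \<and> c \<in> S \<and> (\<exists>\<beta>\<in>G. a = m b \<beta> c)}"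

text \<open>
  The case distinctions are needed because \<^const>\<open>Sup\<close> and \<^const>\<open>Inf\<close> on the reals are
  unspecified on the empty set.
\<close>

definition ifs_prod ::
    "'a set \<Rightarrow> 'g set \<Rightarrow> ('a \<Rightarrow> 'g \<Rightarrow> 'a \<Rightarrow> 'a) \<Rightarrow> 'a fuzzy_pair \<Rightarrow> 'a fuzzy_pair \<Rightarrow> 'a fuzzy_pair" where
  "ifs_prod S G m A B =
    (\<lambda>a\<in>S. if factorizations S G m a = {} then 0
            else (SUP (b, c)\<in>factorizations S G m a. min (fst A b) (fst B c)),
     \<lambda>a\<in>S. if factorizations S G m a = {} then 1
            else (INF (b, c)\<in>factorizations S G m a. max (snd A b) (snd B c)))"

definition ifs_bi_ideal ::
    "'a set \<Rightarrow> 'g set \<Rightarrow> ('a \<Rightarrow> 'g \<Rightarrow> 'a \<Rightarrow> 'a) \<Rightarrow> 'a fuzzy_pair \<Rightarrow> bool" where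
  "ifs_bi_ideal S G m A \<longleftrightarrow> A \<in> IFS S \<and>
    (\<forall>x\<in>S. \<forall>a\<in>S. \<forall>y\<in>S. \<forall>\<alpha>\<in>G. \<forall>\<beta>\<in>G.
      fst A (m x \<alpha> y) \<ge> min (fst A x) (fst A y) \<and>
      snd A (m x \<alpha> y) \<le> max (snd A x) (snd A y) \<and>
      fst A (m (m x \<alpha> a) \<beta> y) \<ge> min (fst A x) (fst A y) \<and>
      snd A (m (m x \<alpha> a) \<beta> y) \<le> max (snd A x) (snd A y))"

end

theory Submission imports Defs begin

text \<open>
  Writing products by juxtaposition, the laws of the groupoid turn intra-regularity into
  \<open>a = (sa)a = (aa)s\<close>. Substituting \<open>a = (aa)s\<close> into \<open>ua\<close> gives \<open>Sa \<subseteq> aS\<close>, and hence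
  \<open>a = (aw)a\<close> and \<open>a = ((aw')a)a\<close>. For a bi-ideal, these two factorizations bound the
  suprema and infima defining the products from one side, and the bi-ideal inequalities
  bound them from the other.
\<close>

context gamma_AG_star_star_groupoid
begin

section \<open>Rearrangement identities for products of four elements\<close>

lemma medial:
  assumes "a \<in> S" "b \<in> S" "c \<in> S" "d \<in> S" "\<alpha> \<in> G" "\<beta> \<in> G" "\<gamma> \<in> G"
  shows "m (m a \<alpha> b) \<beta> (m c \<gamma> d) = m (m a \<alpha> c) \<beta> (m b \<gamma> d)"
proof -
  have "m (m a \<alpha> b) \<beta> (m c \<gamma> d) = m (m (m c \<gamma> d) \<alpha> b) \<beta> a"
    using assms by (intro left_invertive) (auto intro: closed)
  also have "\<dots> = m (m (m b \<gamma> d) \<alpha> c) \<beta> a"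
    using assms by (simp add: left_invertive[of c d b])
  also have "\<dots> = m (m a \<alpha> c) \<beta> (m b \<gamma> d)"
    using assms by (intro left_invertive) (auto intro: closed)
  finally show ?thesis .
qed

text \<open>Pulling \<open>c\<close> out by \<open>star_star\<close> exposes (ab)d, where left
  invertivity exchanges \<open>a\<close> and \<open>d\<close>. Putting \<open>c\<close> back gives
  the paramedial form (db)(ca), which \<open>medial\<close> turns into a full reversal. The
  operators keep their positions throughout.\<close>

lemma reverse_product:
  assumes "a \<in> S" "b \<in> S" "c \<in> S" "d \<in> S" "\<alpha> \<in> G" "\<beta> \<in> G" "\<gamma> \<in> G"
  shows "m (m a \<alpha> b) \<beta> (m c \<gamma> d) = m (m d \<alpha> c) \<beta> (m b \<gamma> a)"
proof -
  have "m (m a \<alpha> b) \<beta> (m c \<gamma> d) = m c \<beta> (m (m a \<alpha> b) \<gamma> d)"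
    using assms by (intro star_star) (auto intro: closed)
  also have "\<dots> = m c \<beta> (m (m d \<alpha> b) \<gamma> a)"
    using assms by (simp add: left_invertive[of a b d])
  also have "\<dots> = m (m d \<alpha> b) \<beta> (m c \<gamma> a)"
    using assms by (intro star_star) (auto intro: closed)
  also have "\<dots> = m (m d \<alpha> c) \<beta> (m b \<gamma> a)"
    using assms by (intro medial)
  finally show ?thesis .
qed

section \<open>Factorizations supplied by intra-regularity\<close>

lemma intra_regular_factorization:
  assumes "intra_regular S G m" "a \<in> S"
  obtains b c \<beta> where "b \<in> S" "c \<in> S" "\<beta> \<in> G" "a = m b \<beta> c"
proof -
  obtain x y \<alpha> \<beta> \<gamma> where "x \<in> S" "y \<in> S" "\<alpha> \<in> G" "\<beta> \<in> G" "\<gamma> \<in> G"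
    and "a = m (m x \<alpha> (m a \<beta> a)) \<gamma> y"
    using assms unfolding intra_regular_def by blast
  with assms(2) show thesis by (intro that[of "m x \<alpha> (m a \<beta> a)" y \<gamma>]) (auto intro: closed)
qed

lemma intra_regular_left:
  assumes "intra_regular S G m" "a \<in> S"
  obtains s \<alpha> \<gamma> where "s \<in> S" "\<alpha> \<in> G" "\<gamma> \<in> G" "a = m (m s \<alpha> a) \<gamma> a"
proof -
  obtain x y \<alpha> \<beta> \<gamma> where xy: "x \<in> S" "y \<in> S" "\<alpha> \<in> G" "\<beta> \<in> G" "\<gamma> \<in> G"
    and a: "a = m (m x \<alpha> (m a \<beta> a)) \<gamma> y"
    using assms unfolding intra_regular_def by blast
  \<comment> \<open>Splitting \<open>y\<close> makes y(xa) a product of two products, so that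
    \<open>reverse_product\<close> can send the last \<open>a\<close> to the front; left invertivity
    then brings it back with all other factors gathered to its left.\<close>
  obtain y1 y2 \<delta> where y: "y1 \<in> S" "y2 \<in> S" "\<delta> \<in> G" "y = m y1 \<delta> y2"
    using intra_regular_factorization[OF assms(1) xy(2)] .
  have "a = m (m a \<alpha> (m x \<beta> a)) \<gamma> y"
    using a xy assms(2) by (simp add: star_star[of x a a])
  also have "\<dots> = m (m y \<alpha> (m x \<beta> a)) \<gamma> a"
    using xy assms(2) by (intro left_invertive) (auto intro: closed)
  also have "m y \<alpha> (m x \<beta> a) = m (m a \<delta> x) \<alpha> (m y2 \<beta> y1)"
    unfolding y(4) using xy y assms(2) by (intro reverse_product)
  also have "\<dots> = m (m (m y2 \<beta> y1) \<delta> x) \<alpha> a"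
    using xy y assms(2) by (intro left_invertive) (auto intro: closed)
  finally show thesis
    using xy y by (intro that[of "m (m y2 \<beta> y1) \<delta> x" \<alpha> \<gamma>]) (auto intro: closed)
qed

text \<open>With a = (aa)s one has ua = (aa)(us) = (su)(aa) = a((su)a): the square is reversed to
  the right and then split by \<open>star_star\<close>. The operator \<delta> survives as the
  outermost one.\<close>

lemma left_multiple_is_right_multiple:
  assumes "intra_regular S G m" "a \<in> S" "u \<in> S" "\<delta> \<in> G"
  obtains v \<gamma> where "v \<in> S" "\<gamma> \<in> G" "m u \<delta> a = m a \<delta> (m v \<gamma> a)"
proof -
  obtain s \<alpha> \<gamma> where s: "s \<in> S" "\<alpha> \<in> G" "\<gamma> \<in> G" "a = m (m s \<alpha> a) \<gamma> a"
    using intra_regular_left[OF assms(1,2)] .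
  \<comment> \<open>Left invertivity exchanges the outer factors of (sa)a.\<close>
  then have "a = m (m a \<alpha> a) \<gamma> s"
    using assms(2) left_invertive[of s a a \<alpha> \<gamma>] by simp
  then have "m u \<delta> a = m u \<delta> (m (m a \<alpha> a) \<gamma> s)" by simp
  also have "\<dots> = m (m a \<alpha> a) \<delta> (m u \<gamma> s)"
    using s assms by (intro star_star) (auto intro: closed)
  also have "\<dots> = m (m s \<alpha> u) \<delta> (m a \<gamma> a)"
    using s assms by (intro reverse_product)
  also have "\<dots> = m a \<delta> (m (m s \<alpha> u) \<gamma> a)"
    using s assms by (intro star_star) (auto intro: closed)
  finally show thesis
    using s assms by (intro that[of "m s \<alpha> u" \<gamma>]) (auto intro: closed)
qed

text \<open>Rewrites the factor sa of a = (sa)a as a right multiple of \<open>a\<close>. The result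
  has the shape (xw)y of the terms in the triple product, with both outer places taken by
  \<open>a\<close> and the middle one left to delta.\<close>

lemma intra_regular_sandwich:
  assumes "intra_regular S G m" "a \<in> S"
  obtains v \<alpha> \<beta> \<gamma> where "v \<in> S" "\<alpha> \<in> G" "\<beta> \<in> G" "\<gamma> \<in> G" "a = m (m a \<alpha> (m v \<beta> a)) \<gamma> a"
  using assms by (metis intra_regular_left left_multiple_is_right_multiple)

text \<open>Meant for the product of A with itself: the left factor (aw)a is one on which a bi-ideal
  is controlled by its values at \<open>a\<close>.\<close>

lemma intra_regular_double_sandwich:
  assumes "intra_regular S G m" "a \<in> S"
  obtains w \<alpha> \<beta> \<gamma> where "w \<in> S" "\<alpha> \<in> G" "\<beta> \<in> G" "\<gamma> \<in> G" "a = m (m (m a \<alpha> w) \<beta> a) \<gamma> a"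
proof -
  obtain u \<alpha> \<beta> \<gamma> where u: "u \<in> S" "\<alpha> \<in> G" "\<beta> \<in> G" "\<gamma> \<in> G" "a = m (m a \<alpha> (m u \<beta> a)) \<gamma> a"
    using intra_regular_sandwich[OF assms] .
  obtain u1 u2 \<epsilon> where uu: "u1 \<in> S" "u2 \<in> S" "\<epsilon> \<in> G" "u = m u1 \<epsilon> u2"
    using intra_regular_factorization[OF assms(1) u(1)] .
  obtain v \<delta> where v: "v \<in> S" "\<delta> \<in> G" "m (m u2 \<beta> u1) \<epsilon> a = m a \<epsilon> (m v \<delta> a)"
    using left_multiple_is_right_multiple[OF assms, of "m u2 \<beta> u1" \<epsilon>] u uu closed by metis
  \<comment> \<open>Only the left factor of the sandwich is reworked: a(ua) = u(aa) = (aa)(u2 u1) =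
    ((u2 u1)a)a, whose inner left multiple of \<open>a\<close> becomes the right multiple
    a(va).\<close>
  have "m a \<alpha> (m u \<beta> a) = m u \<alpha> (m a \<beta> a)"
    using u(1-4) assms by (intro star_star)
  also have "\<dots> = m (m a \<epsilon> a) \<alpha> (m u2 \<beta> u1)"
    unfolding uu(4) using u(1-4) uu assms by (intro reverse_product)
  also have "\<dots> = m (m (m u2 \<beta> u1) \<epsilon> a) \<alpha> a"
    using u(1-4) uu assms by (intro left_invertive) (auto intro: closed)
  also have "\<dots> = m (m a \<epsilon> (m v \<delta> a)) \<alpha> a"
    by (simp add: v(3))
  finally have "m (m a \<epsilon> (m v \<delta> a)) \<alpha> a = m a \<alpha> (m u \<beta> a)" by simp
  with u uu v assms show thesis
    by (intro that[of "m v \<delta> a" \<epsilon> \<alpha> \<gamma>]) (auto intro: closed)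
qed

section \<open>Bounds for the suprema and infima in a product\<close>

lemma factorizations_nonempty:
  assumes "intra_regular S G m" "a \<in> S"
  shows "factorizations S G m a \<noteq> {}"
proof -
  obtain b c \<beta> where "b \<in> S" "c \<in> S" "\<beta> \<in> G" "a = m b \<beta> c"
    using intra_regular_factorization[OF assms] .
  then have "(b, c) \<in> factorizations S G m a"
    unfolding factorizations_def by blast
  then show ?thesis by blast
qed

text \<open>The supremum dominates each term once the family is bounded, and a bound on A suffices
  because the minimum lies below its first argument. Asking just for this bound lets A itself be a
  product.\<close>

lemma fst_ifs_prod_ge:
  assumes "\<And>x. x \<in> S \<Longrightarrow> fst A x \<le> 1" "b \<in> S" "c \<in> S" "\<beta> \<in> G"
  shows "min (fst A b) (fst B c) \<le> fst (ifs_prod S G m A B) (m b \<beta> c)"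
proof -
  let ?F = "factorizations S G m (m b \<beta> c)"
  have bc: "(b, c) \<in> ?F"
    using assms unfolding factorizations_def by blast
  have "bdd_above ((\<lambda>(b, c). min (fst A b) (fst B c)) ` ?F)"
    using assms(1) by (intro bdd_aboveI[of _ 1]) (force simp: factorizations_def min_le_iff_disj)
  from cSUP_upper[OF bc this] show ?thesis
    using bc assms by (auto simp: ifs_prod_def closed)
qed

lemma snd_ifs_prod_le:
  assumes "\<And>x. x \<in> S \<Longrightarrow> 0 \<le> snd A x" "b \<in> S" "c \<in> S" "\<beta> \<in> G"
  shows "snd (ifs_prod S G m A B) (m b \<beta> c) \<le> max (snd A b) (snd B c)"
proof -
  let ?F = "factorizations S G m (m b \<beta> c)"
  have bc: "(b, c) \<in> ?F"
    using assms unfolding factorizations_def by blast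
  have "bdd_below ((\<lambda>(b, c). max (snd A b) (snd B c)) ` ?F)"
    using assms(1) by (intro bdd_belowI[of _ 0]) (force simp: factorizations_def le_max_iff_disj)
  from cINF_lower[OF this bc] show ?thesis
    using bc assms by (auto simp: ifs_prod_def closed)
qed

text \<open>Every element factorizes, so the default value 0 never occurs and a bound on all terms
  bounds the supremum.\<close>

lemma fst_ifs_prod_le:
  assumes "intra_regular S G m" "a \<in> S"
    and "\<And>b c \<beta>. \<lbrakk>b \<in> S; c \<in> S; \<beta> \<in> G; a = m b \<beta> c\<rbrakk> \<Longrightarrow> min (fst A b) (fst B c) \<le> t"
  shows "fst (ifs_prod S G m A B) a \<le> t"
proof -
  have "(SUP (b, c)\<in>factorizations S G m a. min (fst A b) (fst B c)) \<le> t"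
    using factorizations_nonempty[OF assms(1,2)] assms(3)
    by (intro cSUP_least) (auto simp: factorizations_def)
  then show ?thesis
    using factorizations_nonempty[OF assms(1,2)] assms(2) by (simp add: ifs_prod_def)
qed

lemma snd_ifs_prod_ge:
  assumes "intra_regular S G m" "a \<in> S"
    and "\<And>b c \<beta>. \<lbrakk>b \<in> S; c \<in> S; \<beta> \<in> G; a = m b \<beta> c\<rbrakk> \<Longrightarrow> t \<le> max (snd A b) (snd B c)"
  shows "t \<le> snd (ifs_prod S G m A B) a"
proof -
  have "t \<le> (INF (b, c)\<in>factorizations S G m a. max (snd A b) (snd B c))"
    using factorizations_nonempty[OF assms(1,2)] assms(3)
    by (intro cINF_greatest) (auto simp: factorizations_def)
  then show ?thesis
    using factorizations_nonempty[OF assms(1,2)] assms(2) by (simp add: ifs_prod_def)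
qed

lemma ifs_prod_eqI:
  assumes "C \<in> IFS S"
    and "\<And>a. a \<in> S \<Longrightarrow> fst (ifs_prod S G m A B) a = fst C a"
    and "\<And>a. a \<in> S \<Longrightarrow> snd (ifs_prod S G m A B) a = snd C a"
  shows "ifs_prod S G m A B = C"
proof (rule prod_eqI)
  \<comment> \<open>Both sides are undefined off S, so agreement on S gives equality of
    functions.\<close>
  have "fst C \<in> extensional S" "snd C \<in> extensional S"
    using assms(1) by (auto simp: IFS_def PiE_def)
  moreover have "fst (ifs_prod S G m A B) \<in> extensional S"
    "snd (ifs_prod S G m A B) \<in> extensional S"
    by (simp_all add: ifs_prod_def)
  ultimately show "fst (ifs_prod S G m A B) = fst C" "snd (ifs_prod S G m A B) = snd C"
    using assms(2,3) by (auto intro: extensionalityI)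
qed

section \<open>The triple product with delta in the middle\<close>

context
  fixes A :: "'a fuzzy_pair"
  assumes intra: "intra_regular S G m" and ifs: "A \<in> IFS S"
begin

lemma fst_le_1: "x \<in> S \<Longrightarrow> fst A x \<le> 1"
  and snd_ge_0: "x \<in> S \<Longrightarrow> 0 \<le> snd A x"
  using ifs by (auto simp: IFS_def PiE_def Pi_def)

lemma fst_prod_delta_le_1: "x \<in> S \<Longrightarrow> fst (ifs_prod S G m A (ifs_delta S)) x \<le> 1"
  by (rule fst_ifs_prod_le[OF intra]) (auto simp: fst_le_1 min_le_iff_disj)

lemma snd_prod_delta_ge_0: "x \<in> S \<Longrightarrow> 0 \<le> snd (ifs_prod S G m A (ifs_delta S)) x"
  by (rule snd_ifs_prod_ge[OF intra]) (auto simp: snd_ge_0 le_max_iff_disj)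

text \<open>Delta has membership value 1 on S, so the term belonging to the pair (x, w) is just the
  value of A at \<open>x\<close>.\<close>

lemma fst_prod_delta_ge:
  assumes "x \<in> S" "w \<in> S" "\<alpha> \<in> G"
  shows "fst A x \<le> fst (ifs_prod S G m A (ifs_delta S)) (m x \<alpha> w)"
  using fst_ifs_prod_ge[of A x w \<alpha> "ifs_delta S"] assms fst_le_1 by (simp add: ifs_delta_def)

lemma snd_prod_delta_le:
  assumes "x \<in> S" "w \<in> S" "\<alpha> \<in> G"
  shows "snd (ifs_prod S G m A (ifs_delta S)) (m x \<alpha> w) \<le> snd A x"
  using snd_ifs_prod_le[of A x w \<alpha> "ifs_delta S"] assms snd_ge_0 by (simp add: ifs_delta_def)

lemma fst_triple_prod_ge:
  assumes "x \<in> S" "w \<in> S" "y \<in> S" "\<alpha> \<in> G" "\<beta> \<in> G"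
  shows "min (fst A x) (fst A y)
    \<le> fst (ifs_prod S G m (ifs_prod S G m A (ifs_delta S)) A) (m (m x \<alpha> w) \<beta> y)"
  using fst_ifs_prod_ge[OF fst_prod_delta_le_1 closed[of x \<alpha> w], of y \<beta> A]
    fst_prod_delta_ge[of x w \<alpha>] assms by fastforce

lemma snd_triple_prod_le:
  assumes "x \<in> S" "w \<in> S" "y \<in> S" "\<alpha> \<in> G" "\<beta> \<in> G"
  shows "snd (ifs_prod S G m (ifs_prod S G m A (ifs_delta S)) A) (m (m x \<alpha> w) \<beta> y)
    \<le> max (snd A x) (snd A y)"
  using snd_ifs_prod_le[OF snd_prod_delta_ge_0 closed[of x \<alpha> w], of y \<beta> A]
    snd_prod_delta_le[of x w \<alpha>] assms by fastforce

lemma fst_triple_prod_le: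
  assumes "a \<in> S"
    and le: "\<And>x w y \<alpha> \<beta>. \<lbrakk>x \<in> S; w \<in> S; y \<in> S; \<alpha> \<in> G; \<beta> \<in> G; a = m (m x \<alpha> w) \<beta> y\<rbrakk>
      \<Longrightarrow> min (fst A x) (fst A y) \<le> t"
  shows "fst (ifs_prod S G m (ifs_prod S G m A (ifs_delta S)) A) a \<le> t"
proof (rule fst_ifs_prod_le[OF intra assms(1)])
  fix p y \<beta> assume p: "p \<in> S" "y \<in> S" "\<beta> \<in> G" "a = m p \<beta> y"
  show "min (fst (ifs_prod S G m A (ifs_delta S)) p) (fst A y) \<le> t"
  \<comment> \<open>This replaces distributivity of minimum over supremum. If the value at
    \<open>y\<close> exceeds t, then \<open>le\<close> forces the value at \<open>x\<close> below t
    for every factorization p = xw, which bounds the inner supremum.\<close>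
  proof (cases "fst A y \<le> t")
    case False
    have "fst (ifs_prod S G m A (ifs_delta S)) p \<le> t"
    proof (rule fst_ifs_prod_le[OF intra p(1)])
      fix x w \<alpha> assume "x \<in> S" "w \<in> S" "\<alpha> \<in> G" "p = m x \<alpha> w"
      then show "min (fst A x) (fst (ifs_delta S) w) \<le> t"
        using le[of x w y \<alpha> \<beta>] p False by (auto simp: min_le_iff_disj)
    qed
    then show ?thesis by simp
  qed simp
qed

lemma snd_triple_prod_ge:
  assumes "a \<in> S"
    and ge: "\<And>x w y \<alpha> \<beta>. \<lbrakk>x \<in> S; w \<in> S; y \<in> S; \<alpha> \<in> G; \<beta> \<in> G; a = m (m x \<alpha> w) \<beta> y\<rbrakk>
      \<Longrightarrow> t \<le> max (snd A x) (snd A y)"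
  shows "t \<le> snd (ifs_prod S G m (ifs_prod S G m A (ifs_delta S)) A) a"
proof (rule snd_ifs_prod_ge[OF intra assms(1)])
  fix p y \<beta> assume p: "p \<in> S" "y \<in> S" "\<beta> \<in> G" "a = m p \<beta> y"
  show "t \<le> max (snd (ifs_prod S G m A (ifs_delta S)) p) (snd A y)"
  proof (cases "t \<le> snd A y")
    case False
    have "t \<le> snd (ifs_prod S G m A (ifs_delta S)) p"
    proof (rule snd_ifs_prod_ge[OF intra p(1)])
      fix x w \<alpha> assume "x \<in> S" "w \<in> S" "\<alpha> \<in> G" "p = m x \<alpha> w"
      then show "t \<le> max (snd A x) (snd (ifs_delta S) w)"
        using ge[of x w y \<alpha> \<beta>] p False by (auto simp: le_max_iff_disj)
    qed
    then show ?thesis by simp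
  qed simp
qed

section \<open>Bi-ideals and the two product equations\<close>

lemma bi_ideal_imp_triple_prod_eq:
  assumes "ifs_bi_ideal S G m A"
  shows "ifs_prod S G m (ifs_prod S G m A (ifs_delta S)) A = A"
proof (rule ifs_prod_eqI[OF ifs])
  fix a assume a: "a \<in> S"
  obtain v \<alpha> \<beta> \<gamma> where v: "v \<in> S" "\<alpha> \<in> G" "\<beta> \<in> G" "\<gamma> \<in> G" "a = m (m a \<alpha> (m v \<beta> a)) \<gamma> a"
    using intra_regular_sandwich[OF intra a] .
  then have v': "m v \<beta> a \<in> S" using a by (intro closed)
  show "fst (ifs_prod S G m (ifs_prod S G m A (ifs_delta S)) A) a = fst A a"
  proof (rule antisym)
    show "fst (ifs_prod S G m (ifs_prod S G m A (ifs_delta S)) A) a \<le> fst A a"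
      using assms by (intro fst_triple_prod_le[OF a]) (simp add: ifs_bi_ideal_def)
    \<comment> \<open>The sandwich is a single factorization whose term already equals the value of
      A at \<open>a\<close>.\<close>
    show "fst A a \<le> fst (ifs_prod S G m (ifs_prod S G m A (ifs_delta S)) A) a"
      using fst_triple_prod_ge[OF a v' a v(2,4)] by (simp flip: v(5))
  qed
  show "snd (ifs_prod S G m (ifs_prod S G m A (ifs_delta S)) A) a = snd A a"
  proof (rule antisym)
    show "snd A a \<le> snd (ifs_prod S G m (ifs_prod S G m A (ifs_delta S)) A) a"
      using assms by (intro snd_triple_prod_ge[OF a]) (simp add: ifs_bi_ideal_def)
    show "snd (ifs_prod S G m (ifs_prod S G m A (ifs_delta S)) A) a \<le> snd A a"
      using snd_triple_prod_le[OF a v' a v(2,4)] by (simp flip: v(5))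
  qed
qed

lemma bi_ideal_imp_prod_self_eq:
  assumes bi: "ifs_bi_ideal S G m A"
  shows "ifs_prod S G m A A = A"
proof (rule ifs_prod_eqI[OF ifs])
  fix a assume a: "a \<in> S"
  obtain w \<alpha> \<beta> \<gamma> where w: "w \<in> S" "\<alpha> \<in> G" "\<beta> \<in> G" "\<gamma> \<in> G" "a = m (m (m a \<alpha> w) \<beta> a) \<gamma> a"
    using intra_regular_double_sandwich[OF intra a] .
  let ?p = "m (m a \<alpha> w) \<beta> a"
  have p: "?p \<in> S" using w(1-3) a by (intro closed)
  \<comment> \<open>The bi-ideal inequalities for (xa)y, with both outer elements equal to
    \<open>a\<close> and middle element \<open>w\<close>.\<close>
  have "min (fst A a) (fst A a) \<le> fst A ?p" "snd A ?p \<le> max (snd A a) (snd A a)"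
    using bi w(1-3) a unfolding ifs_bi_ideal_def by blast+
  then have A: "fst A a \<le> fst A ?p" "snd A ?p \<le> snd A a" by simp_all
  show "fst (ifs_prod S G m A A) a = fst A a"
  proof (rule antisym)
    show "fst (ifs_prod S G m A A) a \<le> fst A a"
      using bi by (intro fst_ifs_prod_le[OF intra a]) (simp add: ifs_bi_ideal_def)
    show "fst A a \<le> fst (ifs_prod S G m A A) a"
      using fst_ifs_prod_ge[OF fst_le_1 p a w(4), of A] A(1) by (simp flip: w(5))
  qed
  show "snd (ifs_prod S G m A A) a = snd A a"
  proof (rule antisym)
    show "snd A a \<le> snd (ifs_prod S G m A A) a"
      using bi by (intro snd_ifs_prod_ge[OF intra a]) (simp add: ifs_bi_ideal_def)
    show "snd (ifs_prod S G m A A) a \<le> snd A a"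
      using snd_ifs_prod_le[OF snd_ge_0 p a w(4), of A] A(2) by (simp flip: w(5))
  qed
qed

text \<open>Each bi-ideal inequality compares a product's value at xy or (xw)y with one of its
  terms; the two equations replace the product by A.\<close>

lemma prod_eqs_imp_bi_ideal:
  assumes "ifs_prod S G m (ifs_prod S G m A (ifs_delta S)) A = A"
    and "ifs_prod S G m A A = A"
  shows "ifs_bi_ideal S G m A"
  unfolding ifs_bi_ideal_def
  using ifs fst_triple_prod_ge snd_triple_prod_le
    fst_ifs_prod_ge[OF fst_le_1, of _ _ _ A] snd_ifs_prod_le[OF snd_ge_0, of _ _ _ A]
  by (simp add: assms)

end

end

theorem theorem2:
  fixes S :: "'a set" and G :: "'g set" and m :: "'a \<Rightarrow> 'g \<Rightarrow> 'a \<Rightarrow> 'a"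
    and A :: "'a fuzzy_pair"
  assumes "gamma_AG_star_star_groupoid S G m"
    and "intra_regular S G m"
    and "A \<in> IFS S"
  shows "ifs_bi_ideal S G m A \<longleftrightarrow>
    ifs_prod S G m (ifs_prod S G m A (ifs_delta S)) A = A \<and> ifs_prod S G m A A = A"
proof -
  interpret gamma_AG_star_star_groupoid S G m by fact
  show ?thesis
    using bi_ideal_imp_triple_prod_eq[OF assms(2,3)] bi_ideal_imp_prod_self_eq[OF assms(2,3)]
      prod_eqs_imp_bi_ideal[OF assms(2,3)] by blast
qed

end
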